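(* Let $m,n\ge 1$, $A\in\mathbb{R}^{m\times n}$ and $B\in\mathbb{R}^{n\times n}$. Then $\mathrm{Gdet}(AB)=\mathrm{Gdet}(A)\,\mathrm{Gdet}(B)$.
   Context: All matrices are real. Let $m\ge n\ge 1$. $S_m$ is the symmetric group on $\{1,\dots,m\}$ with identity element $(1)$. For $\sigma\in S_m$ let $\Phi(\sigma)$ be the $m\times m$ permutation matrix whose $i$-th row is $e_{\sigma(i)}^T$ ($e_j$ = $j$-th column of $I_m$), let $I_{m\times n}=(e_1,\dots,e_n)$, and $P_\sigma=\Phi(\sigma)I_{m\times n}\in\mathbb{R}^{m\times n}$. For $A\in\mathbb{R}^{m\times n}$ put $A^\sigma=P_\sigma^TA\in\mathbb{R}^{n\times n}$ (so the $j$-th row of $A^\sigma$ is the $\sigma^{-1}(j)$-th row of $A$). Totally order $S_m$ by: $\sigma>\tau$ iff there is $t$ with $\sigma(t)>\tau(t)$ and $\sigma(j)=\tau(j)$ for all $j>t$. Let $\sigma_A=(1)$ if $A$ is not of full column rank, and otherwise $\sigma_A=\max\{\sigma\in S_m:\det(A^\sigma)\neq 0\}$. The principal submatrix of $A$ is $A_P=A^{\sigma_A}$, and $\mathrm{sign}(A)\in\{1,0,-1\}$ is the sign of the real number $\det(A_P)$. If $m<n$, $\mathrm{sign}(A)=0$. The generalized determinant of $A\in\mathbb{R}^{m\times n}$ is $$\mathrm{Gdet}(A)=\mathrm{sign}(A)\Big(\sum_{1\le i_1<\dots<i_n\le m}\det(A_{i_1,\dots,i_n})^2\Big)^{1/2}\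 \text{ if } m\ge n,\qquad \mathrm{Gdet}(A)=0\ \text{ if } m<n,$$ where $A_{i_1,\dots,i_n}$ is the $n\times n$ submatrix formed by rows $i_1,\dots,i_n$ of $A$. (For the square matrix $B$ the same definition is used with $m=n$.) *)

theory Defs
  imports Complex_Main "Jordan_Normal_Form.DL_Rank" "Jordan_Normal_Form.DL_Submatrix"
begin

text \<open>
  Rows, columns and permuted points are numbered from 0: the symmetric group on m points
  consists of the functions that permute the set \<open>{0..<m}\<close>, with identity element \<^term>\<open>id\<close>.
\<close>

definition perm_mat :: "nat \<Rightarrow> (nat \<Rightarrow> nat) \<Rightarrow> real mat" where
  "perm_mat m \<sigma> = mat_of_rows m (map (\<lambda>i. unit_vec m (\<sigma> i)) [0..<m])"

definition eye_mat :: "nat \<Rightarrow> nat \<Rightarrow> real mat" where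
  "eye_mat m n = mat_of_cols m (map (unit_vec m) [0..<n])"

definition P_mat :: "nat \<Rightarrow> nat \<Rightarrow> (nat \<Rightarrow> nat) \<Rightarrow> real mat" where
  "P_mat m n \<sigma> = perm_mat m \<sigma> * eye_mat m n"

definition row_perm :: "real mat \<Rightarrow> (nat \<Rightarrow> nat) \<Rightarrow> real mat" where
  "row_perm A \<sigma> = transpose_mat (P_mat (dim_row A) (dim_col A) \<sigma>) * A"

definition perm_greater :: "nat \<Rightarrow> (nat \<Rightarrow> nat) \<Rightarrow> (nat \<Rightarrow> nat) \<Rightarrow> bool" where
  "perm_greater m \<sigma> \<tau> \<longleftrightarrow> (\<exists>t<m. \<sigma> t > \<tau> t \<and> (\<forall>j. t < j \<and> j < m \<longrightarrow> \<sigma> j = \<tau> j))"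

definition perm_max :: "nat \<Rightarrow> (nat \<Rightarrow> nat) set \<Rightarrow> (nat \<Rightarrow> nat)" where
  "perm_max m S = (THE \<sigma>. \<sigma> \<in> S \<and> (\<forall>\<tau>\<in>S. \<tau> \<noteq> \<sigma> \<longrightarrow> perm_greater m \<sigma> \<tau>))"

text \<open>
  \<open>vec_space.rank m A\<close> is the dimension of the span of the columns of A in the
  space of real vectors of length m.
\<close>

definition full_column_rank :: "real mat \<Rightarrow> bool" where
  "full_column_rank A \<longleftrightarrow> vec_space.rank (dim_row A) A = dim_col A"

definition principal_perm :: "real mat \<Rightarrow> (nat \<Rightarrow> nat)" where
  "principal_perm A =
     (if full_column_rank A
      then perm_max (dim_row A) {\<sigma>. \<sigma> permutes {0..<dim_row A} \<and> det (row_perm A \<sigma>) \<noteq> 0}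
      else id)"

definition principal_submatrix :: "real mat \<Rightarrow> real mat" where
  "principal_submatrix A = row_perm A (principal_perm A)"

definition mat_sign :: "real mat \<Rightarrow> real" where
  "mat_sign A = (if dim_row A < dim_col A then 0 else sgn (det (principal_submatrix A)))"

text \<open>
  An increasing choice of n row indices is encoded as the n-element set of these indices;
  \<^const>\<open>submatrix\<close> lists the chosen rows in increasing order.
\<close>

definition Gdet :: "real mat \<Rightarrow> real" where
  "Gdet A =
     (if dim_row A \<ge> dim_col A
      then mat_sign A *
           sqrt (\<Sum>I | I \<subseteq> {0..<dim_row A} \<and> card I = dim_col A.
                   (det (submatrix A I {0..<dim_col A}))\<^sup>2)
      else 0)"

text \<open>
  The order is total on the permutations of \<open>{0..<m}\<close>, so that \<^const>\<open>perm_max\<close> of a nonempty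
  set of permutations is its greatest element.
\<close>

lemma perm_greater_total:
  assumes "\<sigma> permutes {0..<m}" "\<tau> permutes {0..<m}" "\<sigma> \<noteq> \<tau>"
  shows "perm_greater m \<sigma> \<tau> \<or> perm_greater m \<tau> \<sigma>"
proof -
  define D where "D = {t. t < m \<and> \<sigma> t \<noteq> \<tau> t}"
  have fin: "finite D" by (simp add: D_def)
  obtain x where x: "\<sigma> x \<noteq> \<tau> x" using assms(3) by blast
  have "x < m"
  proof (rule ccontr)
    assume "\<not> x < m"
    then have "x \<notin> {0..<m}" by simp
    then have "\<sigma> x = x" "\<tau> x = x" using assms(1,2) by (blast dest: permutes_not_in)+
    then show False using x by simp
  qed
  then have "D \<noteq> {}" using x by (auto simp: D_def)
  then have t: "Max D < m" "\<sigma> (Max D) \<noteq> \<tau> (Max D)"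
    using Max_in[OF fin] by (auto simp: D_def)
  have eq: "\<sigma> j = \<tau> j" if "Max D < j" "j < m" for j
  proof (rule ccontr)
    assume "\<sigma> j \<noteq> \<tau> j"
    then have "j \<in> D" using that(2) by (simp add: D_def)
    then show False using Max_ge[OF fin] that(1) by (simp add: leD)
  qed
  from t(2) consider "\<sigma> (Max D) > \<tau> (Max D)" | "\<tau> (Max D) > \<sigma> (Max D)" by linarith
  then show ?thesis
  proof cases
    case 1
    then have "perm_greater m \<sigma> \<tau>"
      unfolding perm_greater_def using t(1) eq by (intro exI[of _ "Max D"]) simp
    then show ?thesis ..
  next
    case 2
    then have "perm_greater m \<tau> \<sigma>"
      unfolding perm_greater_def using t(1) eq by (intro exI[of _ "Max D"]) simp
    then show ?thesis ..
  qed
qed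

lemma perm_greater_trans:
  assumes "perm_greater m \<rho> \<sigma>" "perm_greater m \<sigma> \<tau>"
  shows "perm_greater m \<rho> \<tau>"
proof -
  obtain s where s: "s < m" "\<rho> s > \<sigma> s" "\<And>j. s < j \<Longrightarrow> j < m \<Longrightarrow> \<rho> j = \<sigma> j"
    using assms(1) unfolding perm_greater_def by blast
  obtain t where t: "t < m" "\<sigma> t > \<tau> t" "\<And>j. t < j \<Longrightarrow> j < m \<Longrightarrow> \<sigma> j = \<tau> j"
    using assms(2) unfolding perm_greater_def by blast
  consider "s < t" | "s = t" | "t < s" by linarith
  then have "\<rho> (max s t) > \<tau> (max s t)"
  proof cases
    case 1
    then show ?thesis using s(3)[of t] t(1,2) by simp
  next
    case 2
    then show ?thesis using s(2) t(2) by simp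
  next
    case 3
    then show ?thesis using t(3)[of s] s(1,2) by simp
  qed
  then show ?thesis
    unfolding perm_greater_def using s(1,3) t(1,3) by (intro exI[of _ "max s t"]) simp
qed

lemma perm_greater_irrefl: "\<not> perm_greater m \<sigma> \<sigma>"
  by (simp add: perm_greater_def)

lemma perm_max_greatest:
  assumes "S \<subseteq> {\<sigma>. \<sigma> permutes {0..<m}}" "S \<noteq> {}"
  shows "perm_max m S \<in> S \<and> (\<forall>\<tau>\<in>S. \<tau> \<noteq> perm_max m S \<longrightarrow> perm_greater m (perm_max m S) \<tau>)"
proof -
  have "finite S"
    using assms(1) finite_permutations[of "{0..<m}"] finite_subset by blast
  then have "\<exists>\<sigma>\<in>S. \<forall>\<tau>\<in>S. \<tau> \<noteq> \<sigma> \<longrightarrow> perm_greater m \<sigma> \<tau>"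
    using assms(2,1)
  proof (induction S rule: finite_ne_induct)
    case (insert x F)
    then obtain \<sigma> where \<sigma>: "\<sigma> \<in> F" "\<forall>\<tau>\<in>F. \<tau> \<noteq> \<sigma> \<longrightarrow> perm_greater m \<sigma> \<tau>" by auto
    have "perm_greater m \<sigma> x \<or> perm_greater m x \<sigma>"
      using perm_greater_total[of \<sigma> m x] insert.prems insert.hyps \<sigma>(1) by blast
    then show ?case
    proof
      assume "perm_greater m \<sigma> x"
      then show ?thesis using \<sigma> by (intro bexI[of _ \<sigma>]) auto
    next
      assume x: "perm_greater m x \<sigma>"
      have "perm_greater m x \<tau>" if "\<tau> \<in> F" for \<tau>
        using perm_greater_trans[OF x] x \<sigma>(2) that by (cases "\<tau> = \<sigma>") auto
      then show ?thesis by (intro bexI[of _ x]) auto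
    qed
  qed auto
  then obtain \<sigma> where \<sigma>: "\<sigma> \<in> S" "\<forall>\<tau>\<in>S. \<tau> \<noteq> \<sigma> \<longrightarrow> perm_greater m \<sigma> \<tau>" by auto
  have "\<exists>!\<sigma>. \<sigma> \<in> S \<and> (\<forall>\<tau>\<in>S. \<tau> \<noteq> \<sigma> \<longrightarrow> perm_greater m \<sigma> \<tau>)"
  proof (rule ex1I[of _ \<sigma>])
    show "\<sigma> \<in> S \<and> (\<forall>\<tau>\<in>S. \<tau> \<noteq> \<sigma> \<longrightarrow> perm_greater m \<sigma> \<tau>)" using \<sigma> by simp
  next
    fix \<rho>
    assume \<rho>: "\<rho> \<in> S \<and> (\<forall>\<tau>\<in>S. \<tau> \<noteq> \<rho> \<longrightarrow> perm_greater m \<rho> \<tau>)"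
    show "\<rho> = \<sigma>"
    proof (rule ccontr)
      assume ne: "\<rho> \<noteq> \<sigma>"
      have "perm_greater m \<sigma> \<rho>" using \<sigma>(2) \<rho> ne by simp
      moreover have "perm_greater m \<rho> \<sigma>" using \<sigma>(1) \<rho> ne by simp
      ultimately show False using perm_greater_trans perm_greater_irrefl by blast
    qed
  qed
  then show ?thesis
    unfolding perm_max_def by (rule theI')
qed

end

theory Submission
  imports Defs "Jordan_Normal_Form.DL_Rank_Submatrix"
begin

text \<open>
  Left multiplication by a permutation matrix and the choice of rows both commute with right
  multiplication by the square matrix \<open>B\<close>, so every minor of \<open>A * B\<close> is the corresponding minor
  of \<open>A\<close> times \<open>det B\<close>. If \<open>det B \<noteq> 0\<close>, the product therefore has the same rank and the same
  principal permutation as \<open>A\<close>; if \<open>det B = 0\<close>, its sign vanishes. Either way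
  \<open>Gdet (A * B) = Gdet A * det B\<close>. Finally \<open>Gdet B = det B\<close>, because the identity is the
  greatest permutation in the given order.
\<close>

text \<open>The column spaces coincide: \<open>A * B\<close> maps \<open>x\<close> to the image of
  \<open>B *\<^sub>v x\<close> under \<open>A\<close>, and \<open>A *\<^sub>v x\<close> is the image
  of \<open>C *\<^sub>v x\<close> under \<open>A * B\<close> when \<open>C\<close> is a right
  inverse of \<open>B\<close>.\<close>

lemma (in vec_space) rank_mult_invertible_right:
  assumes A: "A \<in> carrier_mat n k" and B: "B \<in> carrier_mat k k" and det: "det B \<noteq> 0"
  shows "rank (A * B) = rank A"
proof -
  \<comment> \<open>The unit \<open>()\<close> only fills the extra parameter of
    \<open>ring_mat\<close>.\<close>
  obtain C where C: "C \<in> carrier_mat k k" and BC: "B * C = 1\<^sub>m k"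
    using det_non_zero_imp_unit[OF B det, of "()"]
    unfolding Units_def ring_mat_def by auto
  have AB: "A * B \<in> carrier_mat n k"
    using A B by simp
  have "col_space (A * B) = col_space A"
    unfolding col_space_eq[OF A] col_space_eq[OF AB]
  proof (intro equalityI subsetI)
    fix y
    assume "y \<in> {y \<in> carrier_vec (dim_row (A * B)).
      \<exists>x\<in>carrier_vec (dim_col (A * B)). A * B *\<^sub>v x = y}"
    then obtain x where x: "x \<in> carrier_vec k" "A * B *\<^sub>v x = y" and y: "y \<in> carrier_vec n"
      using A B by auto
    have "A *\<^sub>v (B *\<^sub>v x) = y"
      using x assoc_mult_mat_vec[OF A B x(1)] by simp
    moreover have "B *\<^sub>v x \<in> carrier_vec k"
      using B x by simp
    ultimately show "y \<in> {y \<in> carrier_vec (dim_row A). \<exists>x\<in>carrier_vec (dim_col A). A *\<^sub>v x = y}"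
      using A y by auto
  next
    fix y
    assume "y \<in> {y \<in> carrier_vec (dim_row A). \<exists>x\<in>carrier_vec (dim_col A). A *\<^sub>v x = y}"
    then obtain x where x: "x \<in> carrier_vec k" "A *\<^sub>v x = y" and y: "y \<in> carrier_vec n"
      using A by auto
    have Cx: "C *\<^sub>v x \<in> carrier_vec k"
      using C x by simp
    have "A * B *\<^sub>v (C *\<^sub>v x) = A *\<^sub>v (B *\<^sub>v (C *\<^sub>v x))"
      by (rule assoc_mult_mat_vec[OF A B Cx])
    also have "B *\<^sub>v (C *\<^sub>v x) = x"
      using assoc_mult_mat_vec[OF B C x(1)] BC x(1) by simp
    finally have "A * B *\<^sub>v (C *\<^sub>v x) = y"
      using x by simp
    then show "y \<in> {y \<in> carrier_vec (dim_row (A * B)).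
      \<exists>x\<in>carrier_vec (dim_col (A * B)). A * B *\<^sub>v x = y}"
      using A B y Cx by auto
  qed
  then show ?thesis
    unfolding rank_def col_space_def by simp
qed

lemma col_submatrix_UNIV:
  assumes "j < card {j. j < dim_col A \<and> j \<in> J}"
  shows "col (submatrix A UNIV J) j = col A (pick J j)"
  by (rule eq_vecI)
    (simp_all add: dim_submatrix submatrix_index[OF _ assms] pick_UNIV pick_le[OF assms] assms)

text \<open>Selecting rows touches only the left factor and selecting columns only the right one;
  \<open>UNIV\<close> keeps the summation index intact.\<close>

lemma submatrix_mult:
  assumes "dim_col A = dim_row B"
  shows "submatrix (A * B) I J = submatrix A I UNIV * submatrix B UNIV J"
proof (rule eq_matI)
  fix i j
  assume "i < dim_row (submatrix A I UNIV * submatrix B UNIV J)"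
    and "j < dim_col (submatrix A I UNIV * submatrix B UNIV J)"
  then have i: "i < card {i. i < dim_row A \<and> i \<in> I}"
    and j: "j < card {j. j < dim_col B \<and> j \<in> J}"
    by (simp_all add: dim_submatrix)
  have "submatrix (A * B) I J $$ (i, j) = (A * B) $$ (pick I i, pick J j)"
    using i j by (intro submatrix_index) simp_all
  also have "\<dots> = row A (pick I i) \<bullet> col B (pick J j)"
    by (rule index_mult_mat(1)[OF pick_le[OF i] pick_le[OF j]])
  also have "row A (pick I i) = row (submatrix A I UNIV) i"
    by (rule row_submatrix_UNIV[OF i, symmetric])
  also have "col B (pick J j) = col (submatrix B UNIV J) j"
    by (rule col_submatrix_UNIV[OF j, symmetric])
  also have "row (submatrix A I UNIV) i \<bullet> col (submatrix B UNIV J) j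
      = (submatrix A I UNIV * submatrix B UNIV J) $$ (i, j)"
    using i j by (intro index_mult_mat(1)[symmetric]) (simp_all add: dim_submatrix)
  finally show "submatrix (A * B) I J $$ (i, j)
    = (submatrix A I UNIV * submatrix B UNIV J) $$ (i, j)" .
qed (simp_all add: dim_submatrix)

lemma submatrix_UNIV_UNIV: "submatrix A UNIV UNIV = A"
  by (rule eq_matI) (simp_all add: submatrix_def pick_UNIV)

lemma pick_atLeast0LessThan: "i < k \<Longrightarrow> pick {0..<k} i = i"
  using pick_reduce_set[of i k UNIV] by (simp add: pick_UNIV atLeast0LessThan lessThan_def)

text \<open>Bridges the column set \<open>{0..<n}\<close> of \<open>Gdet\<close> and the
  \<open>UNIV\<close> of \<open>submatrix_mult\<close>.\<close>

lemma submatrix_all_cols: "submatrix A I {0..<dim_col A} = submatrix A I UNIV"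
  by (rule eq_matI) (simp_all add: submatrix_def pick_UNIV pick_atLeast0LessThan)

lemma submatrix_all_rows: "submatrix A {0..<dim_row A} J = submatrix A UNIV J"
  by (rule eq_matI) (simp_all add: submatrix_def pick_UNIV pick_atLeast0LessThan)

lemma P_mat_carrier: "P_mat m n \<sigma> \<in> carrier_mat m n"
  by (rule carrier_matI) (simp_all add: P_mat_def perm_mat_def eye_mat_def)

lemma P_mat_square_id: "P_mat n n id = 1\<^sub>m n"
proof -
  have "perm_mat n id = 1\<^sub>m n"
    by (rule eq_matI) (simp_all add: perm_mat_def mat_of_rows_index)
  moreover have "eye_mat n n = 1\<^sub>m n"
    by (rule eq_matI) (simp_all add: eye_mat_def mat_of_cols_index)
  ultimately show ?thesis
    by (simp add: P_mat_def)
qed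

lemma row_perm_carrier:
  assumes "A \<in> carrier_mat m n"
  shows "row_perm A \<sigma> \<in> carrier_mat n n"
  using assms P_mat_carrier[of m n \<sigma>] by (simp add: row_perm_def)

text \<open>Since \<open>B\<close> is square, \<open>A * B\<close> has the dimensions of
  \<open>A\<close>, so both sides use the same \<open>P_mat\<close> and associativity
  suffices.\<close>

lemma row_perm_mult:
  assumes "A \<in> carrier_mat m n" and "B \<in> carrier_mat n n"
  shows "row_perm (A * B) \<sigma> = row_perm A \<sigma> * B"
  using assms P_mat_carrier[of m n \<sigma>]
  by (simp add: row_perm_def assoc_mult_mat[of _ n m])

lemma det_row_perm_mult:
  assumes "A \<in> carrier_mat m n" and "B \<in> carrier_mat n n"
  shows "det (row_perm (A * B) \<sigma>) = det (row_perm A \<sigma>) * det B"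
  unfolding row_perm_mult[OF assms] using assms row_perm_carrier det_mult by blast

lemma row_perm_square_id:
  assumes "B \<in> carrier_mat n n"
  shows "row_perm B id = B"
  using assms by (simp add: row_perm_def P_mat_square_id)

text \<open>At the deciding point \<open>t\<close>, the value \<open>\<sigma> t\<close> lies above
  \<open>t\<close>, hence is a fixed point of \<open>\<sigma>\<close>; then \<open>t\<close> and
  \<open>\<sigma> t\<close> have the same image, against injectivity.\<close>

lemma not_perm_greater_id:
  assumes "\<sigma> permutes {0..<m}"
  shows "\<not> perm_greater m \<sigma> id"
proof
  assume "perm_greater m \<sigma> id"
  then obtain t where t: "t < m" "t < \<sigma> t" and fixed: "\<And>j. t < j \<Longrightarrow> j < m \<Longrightarrow> \<sigma> j = j"
    unfolding perm_greater_def by auto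
  have "\<sigma> t < m"
    using permutes_in_image[OF assms, of t] t by simp
  then have "\<sigma> (\<sigma> t) = \<sigma> t"
    using fixed t by simp
  then show False
    using permutes_inj[OF assms] t by (simp add: inj_eq)
qed

lemma principal_perm_square:
  assumes B: "B \<in> carrier_mat n n"
  shows "principal_perm B = id"
proof (cases "full_column_rank B")
  case True
  \<comment> \<open>For a square matrix, full column rank means nonzero determinant; this makes
    \<open>id\<close> a candidate for the maximum.\<close>
  then have det: "det B \<noteq> 0"
    using B vec_space.det_rank_iff[OF B] by (simp add: full_column_rank_def)
  let ?S = "{\<sigma>. \<sigma> permutes {0..<n} \<and> det (row_perm B \<sigma>) \<noteq> 0}"
  have id: "id \<in> ?S"
    using det row_perm_square_id[OF B] by (simp add: permutes_id)
  then have max: "perm_max n ?S \<in> ?S"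
    "\<forall>\<tau>\<in>?S. \<tau> \<noteq> perm_max n ?S \<longrightarrow> perm_greater n (perm_max n ?S) \<tau>"
    using perm_max_greatest[of ?S n] by blast+
  have "perm_max n ?S = id"
  proof (rule ccontr)
    assume "perm_max n ?S \<noteq> id"
    then have "perm_greater n (perm_max n ?S) id"
      using bspec[OF max(2) id] by metis
    then show False
      using max(1) not_perm_greater_id[of "perm_max n ?S" n] by simp
  qed
  then show ?thesis
    using True B by (simp add: principal_perm_def)
qed (simp add: principal_perm_def)

lemma Gdet_square:
  assumes B: "B \<in> carrier_mat n n"
  shows "Gdet B = det B"
proof -
  \<comment> \<open>Only one minor remains, so the square root is the absolute value of
    \<open>det B\<close>, and the sign turns it back into \<open>det B\<close>.\<close>
  have "{I. I \<subseteq> {0..<n} \<and> card I = n} = {{0..<n}}"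
    by (auto dest: card_subset_eq[rotated])
  moreover have "submatrix B {0..<n} {0..<n} = B"
    using submatrix_all_cols[of B "{0..<n}"] submatrix_all_rows[of B UNIV]
      submatrix_UNIV_UNIV[of B] B by simp
  moreover have "mat_sign B = sgn (det B)"
    using B row_perm_square_id[OF B]
    by (simp add: mat_sign_def principal_submatrix_def principal_perm_square[OF B])
  ultimately show ?thesis
    using B by (simp add: Gdet_def sgn_mult_abs)
qed

lemma mat_sign_mult_square:
  assumes A: "A \<in> carrier_mat m n" and B: "B \<in> carrier_mat n n"
  shows "mat_sign (A * B) = mat_sign A * sgn (det B)"
proof (cases "det B = 0")
  case True
  \<comment> \<open>Here \<open>det (row_perm (A * B) \<sigma>)\<close> vanishes for every
    \<open>\<sigma>\<close>, so the principal permutation need not be identified.\<close>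
  then show ?thesis
    using det_row_perm_mult[OF A B] by (simp add: mat_sign_def principal_submatrix_def)
next
  case False
  have "full_column_rank (A * B) \<longleftrightarrow> full_column_rank A"
    using A B vec_space.rank_mult_invertible_right[OF A B False]
    by (simp add: full_column_rank_def)
  \<comment> \<open>The factor \<open>det B\<close> is nonzero, so both maxima range over the same
    set of permutations.\<close>
  then have "principal_perm (A * B) = principal_perm A"
    using False A B by (simp add: principal_perm_def det_row_perm_mult[OF A B])
  then show ?thesis
    using A B
    by (simp add: mat_sign_def principal_submatrix_def det_row_perm_mult[OF A B] sgn_mult)
qed

lemma det_submatrix_mult_square:
  assumes A: "A \<in> carrier_mat m n" and B: "B \<in> carrier_mat n n"
    and I: "I \<subseteq> {0..<m}" "card I = n"
  shows "det (submatrix (A * B) I {0..<n}) = det (submatrix A I {0..<n}) * det B"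
proof -
  \<comment> \<open>\<open>submatrix\<close> counts its rows by the set on the left; the equation
    makes the selected block square, as \<open>det_mult\<close> requires.\<close>
  have rows: "{i. i < m \<and> i \<in> I} = I"
    using I by auto
  have "submatrix (A * B) I {0..<n} = submatrix A I {0..<n} * B"
    using A B submatrix_mult[of A B I "{0..<n}"] submatrix_all_cols[of A I]
      submatrix_all_cols[of B UNIV] submatrix_UNIV_UNIV[of B] by simp
  moreover have "submatrix A I {0..<n} \<in> carrier_mat n n"
    using A I(2) rows by (intro carrier_matI) (simp_all add: dim_submatrix)
  ultimately show ?thesis
    using B by (simp add: det_mult)
qed

lemma Gdet_mult_det:
  assumes A: "A \<in> carrier_mat m n" and B: "B \<in> carrier_mat n n"
  shows "Gdet (A * B) = Gdet A * det B"
proof -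
  let ?S = "{I. I \<subseteq> {0..<m} \<and> card I = n}"
  have "(\<Sum>I\<in>?S. (det (submatrix (A * B) I {0..<n}))\<^sup>2)
      = (\<Sum>I\<in>?S. (det (submatrix A I {0..<n}))\<^sup>2) * (det B)\<^sup>2"
    unfolding sum_distrib_right
    by (rule sum.cong) (simp_all add: det_submatrix_mult_square[OF A B] power_mult_distrib)
  then have "sqrt (\<Sum>I\<in>?S. (det (submatrix (A * B) I {0..<n}))\<^sup>2)
      = sqrt (\<Sum>I\<in>?S. (det (submatrix A I {0..<n}))\<^sup>2) * \<bar>det B\<bar>"
    by (simp add: real_sqrt_mult)
  \<comment> \<open>The root yields only the absolute value of \<open>det B\<close>; its sign comes
    from \<open>mat_sign_mult_square\<close>.\<close>
  moreover have "sgn (det B) * \<bar>det B\<bar> = det B"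
    by (rule sgn_mult_abs)
  ultimately show ?thesis
    using A B mat_sign_mult_square[OF A B] by (simp add: Gdet_def mult.left_commute)
qed

theorem theorem3p7:
  fixes m n :: nat and A B :: "real mat"
  assumes "m \<ge> 1" and "n \<ge> 1"
    and "A \<in> carrier_mat m n" and "B \<in> carrier_mat n n"
  shows "Gdet (A * B) = Gdet A * Gdet B"
  using Gdet_mult_det[OF assms(3,4)] Gdet_square[OF assms(4)] by simp

end
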